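(* A virtually polycyclic group satisfies property (VRC) if and only if it is virtually abelian.
   Context: A subgroup $H$ of a group $K$ is a retract of $K$ if there is a homomorphism $\rho: K \to H$ which restricts to the identity map on $H$. A subgroup $H$ of a group $G$ is a virtual retract of $G$ if there exists a subgroup $K \leqslant G$ with $|G:K|<\infty$, $H \subseteq K$, and $H$ a retract of $K$. A group $G$ has property (VRC) if every cyclic subgroup of $G$ is a virtual retract of $G$. A group is virtually polycyclic (respectively, virtually abelian) if it has a polycyclic (respectively, abelian) subgroup of finite index. *)

theory Defs
  imports "HOL-Algebra.Algebra"
begin

text \<open>A subgroup \<open>H\<close> of \<open>G\<close> is given by its carrier; regarded as a group in its own right it is
  \<open>G\<lparr>carrier := H\<rparr>\<close>.\<close>

definition finite_index :: "'a set \<Rightarrow> ('a, 'b) monoid_scheme \<Rightarrow> bool" where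
  "finite_index H G \<longleftrightarrow> subgroup H G \<and> finite (rcosets\<^bsub>G\<^esub> H)"

definition group_retract :: "'a set \<Rightarrow> ('a, 'b) monoid_scheme \<Rightarrow> bool" where
  "group_retract H K \<longleftrightarrow>
     subgroup H K \<and> (\<exists>\<rho> \<in> hom K (K\<lparr>carrier := H\<rparr>). \<forall>h \<in> H. \<rho> h = h)"

definition virtual_retract :: "'a set \<Rightarrow> ('a, 'b) monoid_scheme \<Rightarrow> bool" where
  "virtual_retract H G \<longleftrightarrow>
     subgroup H G \<and> (\<exists>K. finite_index K G \<and> H \<subseteq> K \<and> group_retract H (G\<lparr>carrier := K\<rparr>))"

definition VRC :: "('a, 'b) monoid_scheme \<Rightarrow> bool" where
  "VRC G \<longleftrightarrow>
     (\<forall>H. subgroup H G \<and> cyclic_group (G\<lparr>carrier := H\<rparr>) \<longrightarrow> virtual_retract H G)"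

text \<open>The end \<open>H\<close> of a finite series \<open>1 = H\<^sub>0 \<lhd> H\<^sub>1 \<lhd> \<dots> \<lhd> H\<^sub>n = H\<close> with cyclic factors;
  the analogue of \<^const>\<open>solvable_seq\<close>.\<close>

inductive polycyclic_seq :: "('a, 'b) monoid_scheme \<Rightarrow> 'a set \<Rightarrow> bool" for G where
  unity: "polycyclic_seq G {\<one>\<^bsub>G\<^esub>}"
| extension: "\<lbrakk>polycyclic_seq G K; K \<lhd> (G\<lparr>carrier := H\<rparr>); subgroup H G;
               cyclic_group ((G\<lparr>carrier := H\<rparr>) Mod K)\<rbrakk> \<Longrightarrow> polycyclic_seq G H"

definition polycyclic :: "('a, 'b) monoid_scheme \<Rightarrow> bool" where
  "polycyclic G \<longleftrightarrow> polycyclic_seq G (carrier G)"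

definition virtually_polycyclic :: "('a, 'b) monoid_scheme \<Rightarrow> bool" where
  "virtually_polycyclic G \<longleftrightarrow> (\<exists>H. finite_index H G \<and> polycyclic (G\<lparr>carrier := H\<rparr>))"

definition virtually_abelian :: "('a, 'b) monoid_scheme \<Rightarrow> bool" where
  "virtually_abelian G \<longleftrightarrow> (\<exists>H. finite_index H G \<and> comm_group (G\<lparr>carrier := H\<rparr>))"

end

theory Submission
  imports Defs
begin

text \<open>
  Suppose (VRC) holds. Climbing a polycyclic series \<open>1 = H\<^sub>0 \<lhd> H\<^sub>1 \<lhd> \<dots>\<close>, one finds finite index
  subgroups \<open>K\<close> whose commutators lie in a subgroup \<open>D\<close> meeting \<open>H\<^sub>i\<close> trivially: then
  \<open>D \<inter> H\<^bsub>i+1\<^esub>\<close> embeds in the cyclic group \<open>H\<^bsub>i+1\<^esub>/H\<^sub>i\<close>, so it is a virtual retract, and the kernel of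
  the retraction contains all commutators of its domain but no nontrivial element of
  \<open>D \<inter> H\<^bsub>i+1\<^esub>\<close>. At the top of the series the commutators vanish.

  Conversely, let \<open>A\<close> be a normal abelian subgroup of finite index and \<open>S = \<langle>h\<rangle>\<close>. Zorn's lemma gives
  \<open>C \<le> A\<close> that complements \<open>S\<close> up to torsion, hence up to finite index as \<open>A\<close> is polycyclic. If \<open>h\<close>
  has finite order, the normal core \<open>B\<close> of \<open>C\<close> satisfies \<open>B \<inter> S = 1\<close> and has finite index. If not,
  take \<open>B\<close> to be the preimage of \<open>C\<close> under the norm \<open>A \<rightarrow> A\<close> of the action of \<open>h\<close>. In both cases \<open>S\<close>
  normalises \<open>B\<close>, and projecting \<open>BS\<close> to \<open>S\<close> is the required retraction.
\<close>

section \<open>Subgroups of finite index\<close>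

context group
begin

text \<open>Elementwise form of finite index: \<open>F\<close> contains a representative of every
  right coset. With the converse \<open>finite_index_cover\<close>, later index arguments reduce to
  choosing finite sets of representatives.\<close>

lemma finite_index_obtain_cover:
  assumes "finite_index L G"
  obtains F where "finite F" "F \<subseteq> carrier G" "\<And>x. x \<in> carrier G \<Longrightarrow> \<exists>f\<in>F. x \<otimes> inv f \<in> L"
proof -
  have L: "subgroup L G" and fin: "finite ((\<lambda>x. L #> x) ` carrier G)"
    using assms by (auto simp: finite_index_def RCOSETS_def UNION_singleton_eq_range)
  obtain F where F: "F \<subseteq> carrier G" "finite F" "(\<lambda>x. L #> x) ` carrier G = (\<lambda>x. L #> x) ` F"
    using finite_subset_image[OF fin subset_refl] by metis
  have "\<exists>f\<in>F. x \<otimes> inv f \<in> L" if x: "x \<in> carrier G" for x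
  proof -
    obtain f where f: "f \<in> F" "L #> x = L #> f"
      using F(3) x by (metis (no_types, lifting) imageE imageI)
    then show ?thesis
      by (metis F(1) L is_group rcos_self subgroup.rcos_module_imp subsetD x)
  qed
  with F that show thesis by blast
qed

lemma finite_index_cover:
  assumes L: "subgroup L G" and F: "finite F" "F \<subseteq> carrier G"
    and cover: "\<And>x. x \<in> carrier G \<Longrightarrow> \<exists>f\<in>F. x \<otimes> inv f \<in> L"
  shows "finite_index L G"
proof -
  have "rcosets L \<subseteq> (\<lambda>x. L #> x) ` F"
  proof
    fix C assume "C \<in> rcosets L"
    then obtain x where x: "x \<in> carrier G" "C = L #> x"
      by (auto simp: RCOSETS_def)
    then obtain f where f: "f \<in> F" "x \<otimes> inv f \<in> L"
      using cover by blast
    then have "x \<in> L #> f"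
      by (meson F(2) L is_group subgroup.rcos_module_rev subsetD x(1))
    then have "L #> x = L #> f"
      using F(2) L f(1) repr_independence by blast
    with f(1) x(2) show "C \<in> (\<lambda>x. L #> x) ` F" by blast
  qed
  with L F(1) show ?thesis
    unfolding finite_index_def by (meson finite_imageI finite_subset)
qed

text \<open>Each fibre of \<open>f\<close> lies in one right coset of \<open>L\<close>, so the index
  is at most the number of values of \<open>f\<close>.\<close>

lemma finite_index_separated:
  assumes L: "subgroup L G" and fin: "finite (f ` carrier G)"
    and sep: "\<And>x y. \<lbrakk>x \<in> carrier G; y \<in> carrier G; f x = f y\<rbrakk> \<Longrightarrow> x \<otimes> inv y \<in> L"
  shows "finite_index L G"
proof -
  obtain F where F: "F \<subseteq> carrier G" "finite F" "f ` carrier G = f ` F"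
    using finite_subset_image[OF fin subset_refl] by metis
  show ?thesis
  proof (rule finite_index_cover[OF L F(2,1)])
    fix x assume x: "x \<in> carrier G"
    then obtain y where "y \<in> F" "f x = f y"
      using F(3) by (metis (no_types, lifting) imageE imageI)
    with sep[OF x] F(1) show "\<exists>y\<in>F. x \<otimes> inv y \<in> L" by blast
  qed
qed

lemma rcos_eq_imp_mult_inv_mem:
  assumes "subgroup L G" "x \<in> carrier G" "y \<in> carrier G" "L #> x = L #> y"
  shows "x \<otimes> inv y \<in> L"
  by (metis assms is_group rcos_self subgroup.rcos_module_imp)

lemma finite_index_subgroup: "finite_index L G \<Longrightarrow> subgroup L G"
  by (simp add: finite_index_def)

lemma finite_index_carrier: "finite_index (carrier G) G"
  by (rule finite_index_cover[where F = "{\<one>}"]) (auto intro: subgroup_self)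

lemma finite_index_Int:
  assumes "finite_index L G" "finite_index M G"
  shows "finite_index (L \<inter> M) G"
proof (rule finite_index_separated)
  have L: "subgroup L G" "finite (rcosets L)" and M: "subgroup M G" "finite (rcosets M)"
    using assms by (auto simp: finite_index_def)
  show "subgroup (L \<inter> M) G"
    by (rule subgroups_Inter_pair[OF L(1) M(1)])
  show "finite ((\<lambda>x. (L #> x, M #> x)) ` carrier G)"
    by (rule finite_subset[of _ "(rcosets L) \<times> (rcosets M)"])
      (use L M in \<open>auto simp: RCOSETS_def\<close>)
  show "x \<otimes> inv y \<in> L \<inter> M"
    if "x \<in> carrier G" "y \<in> carrier G" "(L #> x, M #> x) = (L #> y, M #> y)" for x y
    using that L M rcos_eq_imp_mult_inv_mem by auto
qed

text \<open>If every element of \<open>G\<close> is in some coset At and \<open>F\<close> covers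
  \<open>A\<close> modulo \<open>M\<close>, then the finitely many products ft cover
  \<open>G\<close> modulo \<open>M\<close>.\<close>

lemma finite_index_trans_cover:
  assumes A: "finite_index A G" and M: "subgroup M G" and F: "finite F" "F \<subseteq> carrier G"
    and cover: "\<And>x. x \<in> A \<Longrightarrow> \<exists>f\<in>F. x \<otimes> inv f \<in> M"
  shows "finite_index M G"
proof -
  obtain T where T: "finite T" "T \<subseteq> carrier G" "\<And>x. x \<in> carrier G \<Longrightarrow> \<exists>t\<in>T. x \<otimes> inv t \<in> A"
    using finite_index_obtain_cover[OF A] by metis
  show ?thesis
  proof (rule finite_index_cover[OF M, where F = "(\<lambda>(f, t). f \<otimes> t) ` (F \<times> T)"])
    show "finite ((\<lambda>(f, t). f \<otimes> t) ` (F \<times> T))" using F T by blast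
    show "(\<lambda>(f, t). f \<otimes> t) ` (F \<times> T) \<subseteq> carrier G" using F T by auto
    fix x assume x: "x \<in> carrier G"
    obtain t where t: "t \<in> T" "x \<otimes> inv t \<in> A" using T(3) x by blast
    obtain f where f: "f \<in> F" "x \<otimes> inv t \<otimes> inv f \<in> M" using cover t by blast
    have "f \<in> carrier G" "t \<in> carrier G" using f t F T by auto
    then have "x \<otimes> inv t \<otimes> inv f = x \<otimes> inv (f \<otimes> t)"
      using x by (simp add: inv_mult_group m_assoc)
    with f t show "\<exists>u\<in>(\<lambda>(f, t). f \<otimes> t) ` (F \<times> T). x \<otimes> inv u \<in> M"
      by (intro bexI[of _ "f \<otimes> t"]) auto
  qed
qed

lemma finite_index_mono:
  assumes "finite_index L G" "L \<subseteq> M" "subgroup M G"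
  shows "finite_index M G"
  by (rule finite_index_trans_cover[OF assms(1,3), of "{\<one>}"])
    (use assms finite_index_subgroup[OF assms(1)] in \<open>auto simp: subsetD subgroup.mem_carrier[of L]\<close>)

section \<open>Conjugation and normal cores\<close>

lemma conj_mult:
  assumes "g \<in> carrier G" "x \<in> carrier G" "y \<in> carrier G"
  shows "g \<otimes> (x \<otimes> y) \<otimes> inv g = (g \<otimes> x \<otimes> inv g) \<otimes> (g \<otimes> y \<otimes> inv g)"
proof -
  have "inv g \<otimes> (g \<otimes> (y \<otimes> inv g)) = y \<otimes> inv g"
    using assms by (simp flip: m_assoc)
  with assms show ?thesis by (simp add: m_assoc)
qed

lemma conj_inv:
  assumes "g \<in> carrier G" "x \<in> carrier G"
  shows "g \<otimes> inv x \<otimes> inv g = inv (g \<otimes> x \<otimes> inv g)"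
  using assms by (simp add: m_assoc inv_mult_group)

lemma normal_core:
  assumes "finite_index L G"
  obtains N where "finite_index N G" "N \<lhd> G" "N \<subseteq> L"
proof -
  have L: "subgroup L G" "finite (rcosets L)"
    using assms by (auto simp: finite_index_def)
  define N where "N = {x \<in> carrier G. \<forall>g\<in>carrier G. g \<otimes> x \<otimes> inv g \<in> L}"
  have N: "subgroup N G"
  proof (rule subgroupI)
    show "N \<subseteq> carrier G" by (auto simp: N_def)
    have "\<one> \<in> N" using L(1) by (auto simp: N_def subgroup.one_closed)
    then show "N \<noteq> {}" by blast
    show "inv a \<in> N" if "a \<in> N" for a
      using that L(1) by (auto simp: N_def conj_inv subgroup.m_inv_closed)
    show "a \<otimes> b \<in> N" if "a \<in> N" "b \<in> N" for a b
      using that L(1) by (auto simp: N_def conj_mult subgroup.m_closed)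
  qed
  have "N \<lhd> G"
    unfolding normal_inv_iff
  proof (intro conjI ballI N)
    fix x h assume x: "x \<in> carrier G" and h: "h \<in> N"
    then have h': "h \<in> carrier G" by (auto simp: N_def)
    have "g \<otimes> (x \<otimes> h \<otimes> inv x) \<otimes> inv g = (g \<otimes> x) \<otimes> h \<otimes> inv (g \<otimes> x)" if "g \<in> carrier G" for g
      using that x h' by (simp add: m_assoc inv_mult_group)
    with h x h' show "x \<otimes> h \<otimes> inv x \<in> N" by (simp add: N_def)
  qed
  moreover have "N \<subseteq> L"
  proof
    fix x assume "x \<in> N"
    then have "x \<in> carrier G" "\<one> \<otimes> x \<otimes> inv \<one> \<in> L" unfolding N_def by blast+
    then show "x \<in> L" by simp
  qed
  moreover have "finite_index N G"
  proof (rule finite_index_separated[OF N])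
    \<comment> \<open>\<open>?f x\<close> is the action of \<open>x\<close> on the right cosets of
      \<open>L\<close> by right multiplication. A finite set has finitely many self-maps, and two
      elements acting alike differ by an element of the kernel \<open>N\<close>.\<close>
    let ?f = "\<lambda>x. \<lambda>C\<in>rcosets L. C #> x"
    have "C #> x \<in> rcosets L" if "C \<in> rcosets L" "x \<in> carrier G" for C x
      using that L(1) by (auto simp: RCOSETS_def coset_mult_assoc subgroup.subset)
    then have "?f ` carrier G \<subseteq> (rcosets L) \<rightarrow>\<^sub>E (rcosets L)"
      by (auto simp: PiE_def Pi_def)
    then show "finite (?f ` carrier G)"
      using L(2) by (meson finite_PiE finite_subset)
    fix x y assume xy: "x \<in> carrier G" "y \<in> carrier G" "?f x = ?f y"
    have "g \<otimes> (x \<otimes> inv y) \<otimes> inv g \<in> L" if g: "g \<in> carrier G" for g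
    proof -
      have "L #> g \<in> rcosets L" using g L(1) rcosetsI subgroup.subset by blast
      with fun_cong[OF xy(3), of "L #> g"] have "L #> g #> x = L #> g #> y" by simp
      then have "L #> (g \<otimes> x) = L #> (g \<otimes> y)"
        using g xy L(1) by (simp add: coset_mult_assoc subgroup.subset)
      then have "(g \<otimes> x) \<otimes> inv (g \<otimes> y) \<in> L"
        using rcos_eq_imp_mult_inv_mem L(1) g xy by simp
      then show ?thesis using g xy by (simp add: m_assoc inv_mult_group)
    qed
    then show "x \<otimes> inv y \<in> N" using xy by (simp add: N_def)
  qed
  ultimately show thesis using that by blast
qed

end

section \<open>Cyclic groups and polycyclic series\<close>

text \<open>The image of \<open>L\<close> in the cyclic quotient is again cyclic. The set
  \<open>E\<close> collects the exponents of the generator \<open>z\<close> that occur in this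
  image; an element \<open>g\<close> realising the least positive one generates the image, by
  division with remainder.\<close>

lemma (in normal) subgroup_generator_mod_cyclic:
  assumes cyc: "cyclic_group (G Mod H)" and L: "subgroup L G"
  obtains g where "g \<in> L" "\<And>l. l \<in> L \<Longrightarrow> \<exists>k::int. l \<otimes> inv (g [^] k) \<in> H"
proof -
  interpret Q: group "G Mod H" by (rule factorgroup_is_group)
  interpret h: group_hom G "G Mod H" "(#>) H"
    by (simp add: group_hom_def group_hom_axioms_def is_group Q.is_group r_coset_hom_Mod)
  obtain z where z: "z \<in> carrier (G Mod H)" "carrier (G Mod H) = range (\<lambda>n::int. z [^]\<^bsub>G Mod H\<^esub> n)"
    using cyc[unfolded Q.cyclic_group] that by (elim bexE)
  define E where "E = {p::int. \<exists>l\<in>L. H #> l = z [^]\<^bsub>G Mod H\<^esub> p}"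
  have LG: "l \<in> carrier G" if "l \<in> L" for l
    using subgroup.mem_carrier[OF L that] .
  have inE: "\<exists>p\<in>E. H #> l = z [^]\<^bsub>G Mod H\<^esub> p" if "l \<in> L" for l
  proof -
    have "H #> l \<in> carrier (G Mod H)" using LG[OF that] by (simp add: carrier_FactGroup)
    then obtain p :: int where p: "H #> l = z [^]\<^bsub>G Mod H\<^esub> p" unfolding z(2) by (elim rangeE)
    then have "p \<in> E" unfolding E_def using that by (intro CollectI bexI)
    with p show ?thesis by (rule bexI)
  qed
  \<comment> \<open>The Euclidean step: dividing by a power of \<open>g\<close> lowers the exponent
    p by a multiple of d and stays in \<open>L\<close>.\<close>
  have red: "\<exists>l'\<in>L. l' = l \<otimes> inv (g [^] q) \<and> H #> l' = z [^]\<^bsub>G Mod H\<^esub> (p - d * q)"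
    if "l \<in> L" "g \<in> L" "H #> l = z [^]\<^bsub>G Mod H\<^esub> p" "H #> g = z [^]\<^bsub>G Mod H\<^esub> d" for l g p d and q :: int
  proof -
    have "l \<otimes> inv (g [^] q) \<in> L"
      using that(1,2) L by (simp add: subgroup_int_pow_closed subgroup.m_closed subgroup.m_inv_closed)
    moreover have "H #> (l \<otimes> inv (g [^] q)) = z [^]\<^bsub>G Mod H\<^esub> (p - d * q)"
      using that LG[OF that(1)] LG[OF that(2)] z(1)
      by (simp add: h.hom_mult h.hom_inv h.hom_int_pow Q.int_pow_diff Q.int_pow_pow del: mult_FactGroup)
    ultimately show ?thesis by blast
  qed
  have one: "x \<in> H" if "x \<in> carrier G" "H #> x = \<one>\<^bsub>G Mod H\<^esub>" for x
    using that by (metis is_group one_FactGroup subgroup_axioms group.rcos_self)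
  have oneL: "\<one> \<in> L" using L by (rule subgroup.one_closed)
  show thesis
  proof (cases "\<exists>n::nat. 0 < n \<and> int n \<in> E")
    \<comment> \<open>\<open>E\<close> has no positive member, and it is closed under negation
      because \<open>L\<close> is closed under inverses. Only the exponent 0 remains, so
      \<open>L\<close> lies in \<open>H\<close> and \<one> serves as generator.\<close>
    case False
    have "l \<in> H" if l: "l \<in> L" for l
    proof -
      obtain p where p: "p \<in> E" "H #> l = z [^]\<^bsub>G Mod H\<^esub> p" using inE l by blast
      have "\<exists>l'\<in>L. H #> l' = z [^]\<^bsub>G Mod H\<^esub> (- p)"
        using red[OF oneL l _ p(2), of 0 1] by auto
      then have "- p \<in> E" by (auto simp: E_def)
      with False p(1) have "p = 0"
        by (metis add.inverse_inverse add.inverse_neutral int_cases2 of_nat_0_less_iff neq0_conv of_nat_0)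
      with p(2) have "H #> l = \<one>\<^bsub>G Mod H\<^esub>" by simp
      with one l LG show ?thesis by blast
    qed
    then show thesis using oneL that[of \<one>] LG by auto
  next
    case True
    define d where "d = (LEAST n::nat. 0 < n \<and> int n \<in> E)"
    have d: "0 < d" "int d \<in> E" using LeastI_ex[OF True] by (auto simp: d_def)
    then obtain g where g: "g \<in> L" "H #> g = z [^]\<^bsub>G Mod H\<^esub> int d" by (auto simp: E_def)
    have "\<exists>k::int. l \<otimes> inv (g [^] k) \<in> H" if l: "l \<in> L" for l
    proof -
      obtain p where p: "p \<in> E" "H #> l = z [^]\<^bsub>G Mod H\<^esub> p" using inE l by blast
      define r where "r = p mod int d"
      have r: "p - int d * (p div int d) = r" by (simp add: r_def minus_mult_div_eq_mod)
      obtain l' where l': "l' \<in> L" "l' = l \<otimes> inv (g [^] (p div int d))" "H #> l' = z [^]\<^bsub>G Mod H\<^esub> r"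
        using red[OF l g(1) p(2) g(2), of "p div int d"] unfolding r by blast
      have "0 \<le> r" "r < int d" using d(1) by (simp_all add: r_def)
      moreover have "int (nat r) \<in> E" using l' \<open>0 \<le> r\<close> by (auto simp: E_def)
      ultimately have "r = 0"
        using not_less_Least[of "nat r" "\<lambda>n. 0 < n \<and> int n \<in> E", folded d_def] by linarith
      with l' have "l' \<in> H" using one LG by auto
      with l'(2) show ?thesis by blast
    qed
    with g(1) that show thesis by blast
  qed
qed

context group
begin

text \<open>The form needed for a factor \<open>H\<close>/\<open>N\<close> of a polycyclic series,
  with products and powers taken in \<open>G\<close>.\<close>

lemma subgroup_generator_mod_cyclic_section:
  assumes N: "N \<lhd> (G\<lparr>carrier := H\<rparr>)" and H: "subgroup H G"
    and cyc: "cyclic_group ((G\<lparr>carrier := H\<rparr>) Mod N)"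
    and L: "subgroup L G" "L \<subseteq> H"
  obtains g where "g \<in> L" "\<And>l. l \<in> L \<Longrightarrow> \<exists>k::int. l \<otimes> inv (g [^] k) \<in> N"
proof -
  obtain g where g: "g \<in> L"
    "\<And>l. l \<in> L \<Longrightarrow> \<exists>k::int. l \<otimes>\<^bsub>G\<lparr>carrier := H\<rparr>\<^esub> inv\<^bsub>G\<lparr>carrier := H\<rparr>\<^esub> (g [^]\<^bsub>G\<lparr>carrier := H\<rparr>\<^esub> k) \<in> N"
    using normal.subgroup_generator_mod_cyclic[OF N cyc subgroup_incl[OF L(1) H L(2)]] by metis
  have "g [^] k \<in> H" for k :: int using g(1) H L(2) subgroup_int_pow_closed by blast
  with g that H L(2) show thesis
    by (simp add: int_pow_consistent[OF H, symmetric] subsetD)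
qed

lemma polycyclic_seq_subgroup:
  assumes "polycyclic_seq (G\<lparr>carrier := P\<rparr>) H" "subgroup P G"
  shows "polycyclic_seq G H"
  using assms(1)
proof induction
  case unity
  then show ?case using polycyclic_seq.unity[of G] by simp
next
  case (extension K H)
  then show ?case using incl_subgroup[OF assms(2)] by (auto intro: polycyclic_seq.extension)
qed

lemma subgroup_cyclic_iff:
  assumes "subgroup H G"
  shows "cyclic_group (G\<lparr>carrier := H\<rparr>) \<longleftrightarrow> (\<exists>h\<in>H. H = range (\<lambda>i::int. h [^] i))"
proof -
  interpret H: group "G\<lparr>carrier := H\<rparr>" by (rule subgroup_imp_group[OF assms])
  show ?thesis by (auto simp: H.cyclic_group int_pow_consistent[OF assms])
qed

lemma cyclic_subgroup:
  assumes "h \<in> carrier G"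
  shows "subgroup (range (\<lambda>i::int. h [^] i)) G"
proof -
  have "generate G {h} = range (\<lambda>i::int. h [^] i)" using generate_pow[OF assms] by auto
  with generate_is_subgroup[of "{h}"] assms show ?thesis by simp
qed

end

section \<open>Complements\<close>

context group
begin

text \<open>The multiplication rule of a semidirect product. It gives both the closure of BH under
  products and the homomorphism property of the projection to the second factor.\<close>

lemma mult_conj_swap:
  assumes "b \<in> carrier G" "h \<in> carrier G" "c \<in> carrier G" "k \<in> carrier G"
  shows "(b \<otimes> h) \<otimes> (c \<otimes> k) = (b \<otimes> (h \<otimes> c \<otimes> inv h)) \<otimes> (h \<otimes> k)"
proof -
  have "inv h \<otimes> (h \<otimes> k) = k" using assms by (simp flip: m_assoc)
  with assms show ?thesis by (simp add: m_assoc)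
qed

lemma subgroup_set_mult_normalised:
  assumes B: "subgroup B G" and H: "subgroup H G"
    and norm: "\<And>h b. \<lbrakk>h \<in> H; b \<in> B\<rbrakk> \<Longrightarrow> h \<otimes> b \<otimes> inv h \<in> B"
  shows "subgroup (B <#> H) G"
proof (rule subgroupI)
  have BG: "b \<in> carrier G" if "b \<in> B" for b using subgroup.mem_carrier[OF B that] .
  have HG: "h \<in> carrier G" if "h \<in> H" for h using subgroup.mem_carrier[OF H that] .
  have mem: "x \<in> B <#> H \<longleftrightarrow> (\<exists>b\<in>B. \<exists>h\<in>H. x = b \<otimes> h)" for x by (simp add: set_mult_def)
  show "B <#> H \<subseteq> carrier G" using BG HG by (auto simp: mem)
  show "B <#> H \<noteq> {}"
    using subgroup.one_closed[OF B] subgroup.one_closed[OF H] by (auto simp: set_mult_def)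
  show "inv a \<in> B <#> H" if aBH: "a \<in> B <#> H" for a
  proof -
    obtain b h where b: "b \<in> B" and h: "h \<in> H" and a: "a = b \<otimes> h" using aBH mem by blast
    have "inv h \<otimes> inv b \<otimes> inv (inv h) \<in> B"
      using norm[of "inv h" "inv b"] b h B H by (simp add: subgroup.m_inv_closed)
    moreover have "inv a = (inv h \<otimes> inv b \<otimes> inv (inv h)) \<otimes> inv h"
      using BG[OF b] HG[OF h] by (simp add: a m_assoc inv_mult_group)
    moreover have "inv h \<in> H" using h H by (simp add: subgroup.m_inv_closed)
    ultimately show ?thesis using mem by blast
  qed
  show "x \<otimes> y \<in> B <#> H" if xy: "x \<in> B <#> H" "y \<in> B <#> H" for x y
  proof -
    obtain b h where b: "b \<in> B" and h: "h \<in> H" and x: "x = b \<otimes> h" using xy(1) mem by blast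
    obtain c k where c: "c \<in> B" and k: "k \<in> H" and y: "y = c \<otimes> k" using xy(2) mem by blast
    have "x \<otimes> y = (b \<otimes> (h \<otimes> c \<otimes> inv h)) \<otimes> (h \<otimes> k)"
      unfolding x y using BG[OF b] HG[OF h] BG[OF c] HG[OF k] by (rule mult_conj_swap)
    moreover have "b \<otimes> (h \<otimes> c \<otimes> inv h) \<in> B" using b c h norm B by (simp add: subgroup.m_closed)
    moreover have "h \<otimes> k \<in> H" using h k H by (simp add: subgroup.m_closed)
    ultimately show ?thesis using mem by blast
  qed
qed

text \<open>BH is an internal semidirect product with normal factor \<open>B\<close>, and its
  projection to \<open>H\<close> is the retraction.\<close>

lemma virtual_retract_of_complement:
  assumes B: "subgroup B G" and H: "subgroup H G"
    and norm: "\<And>h b. \<lbrakk>h \<in> H; b \<in> B\<rbrakk> \<Longrightarrow> h \<otimes> b \<otimes> inv h \<in> B"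
    and triv: "B \<inter> H \<subseteq> {\<one>}"
    and fin: "finite_index (B <#> H) G"
  shows "virtual_retract H G"
proof -
  define K where "K = B <#> H"
  have K: "subgroup K G" using fin by (simp add: K_def finite_index_def)
  have BG: "b \<in> carrier G" if "b \<in> B" for b using subgroup.mem_carrier[OF B that] .
  have HG: "h \<in> carrier G" if "h \<in> H" for h using subgroup.mem_carrier[OF H that] .
  have mem: "x \<in> K \<longleftrightarrow> (\<exists>b\<in>B. \<exists>h\<in>H. x = b \<otimes> h)" for x by (simp add: K_def set_mult_def)
  have HK: "H \<subseteq> K"
  proof
    fix h assume "h \<in> H"
    then show "h \<in> K" unfolding mem
      using HG subgroup.one_closed[OF B] by (intro bexI[of _ \<one>] bexI[of _ h]) auto
  qed
  \<comment> \<open>The \<open>H\<close>-component of \<open>x\<close>; it is unique because two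
    candidates differ by an element of \<open>B\<close> \<inter> \<open>H\<close>.\<close>
  define \<rho> where "\<rho> x = (THE y. y \<in> H \<and> x \<otimes> inv y \<in> B)" for x
  have \<rho>: "\<rho> (b \<otimes> h) = h" if b: "b \<in> B" and h: "h \<in> H" for b h
    unfolding \<rho>_def
  proof (rule the_equality)
    show "h \<in> H \<and> b \<otimes> h \<otimes> inv h \<in> B" using b h BG HG by (simp add: m_assoc)
    fix y assume y: "y \<in> H \<and> b \<otimes> h \<otimes> inv y \<in> B"
    then have "inv b \<otimes> (b \<otimes> h \<otimes> inv y) \<in> B" using b B by (simp add: subgroup.m_closed subgroup.m_inv_closed)
    moreover have "inv b \<otimes> (b \<otimes> h \<otimes> inv y) = h \<otimes> inv y"
      using b h y BG HG by (simp flip: m_assoc)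
    moreover have "h \<otimes> inv y \<in> H" using h y H by (simp add: subgroup.m_closed subgroup.m_inv_closed)
    ultimately have "h \<otimes> inv y = \<one>" using triv by auto
    then show "y = h" using h y HG by (metis inv_closed inv_equality inv_inv)
  qed
  have "\<rho> \<in> hom (G\<lparr>carrier := K\<rparr>) (G\<lparr>carrier := K\<rparr>\<lparr>carrier := H\<rparr>)"
  proof (rule homI)
    fix x assume "x \<in> carrier (G\<lparr>carrier := K\<rparr>)"
    then have "x \<in> K" by simp
    then show "\<rho> x \<in> carrier (G\<lparr>carrier := K\<rparr>\<lparr>carrier := H\<rparr>)" using \<rho> mem by auto
  next
    fix x y assume "x \<in> carrier (G\<lparr>carrier := K\<rparr>)" "y \<in> carrier (G\<lparr>carrier := K\<rparr>)"
    then have xy: "x \<in> K" "y \<in> K" by auto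
    obtain b h where b: "b \<in> B" and h: "h \<in> H" and x: "x = b \<otimes> h" using xy(1) mem by blast
    obtain c k where c: "c \<in> B" and k: "k \<in> H" and y: "y = c \<otimes> k" using xy(2) mem by blast
    have "x \<otimes> y = (b \<otimes> (h \<otimes> c \<otimes> inv h)) \<otimes> (h \<otimes> k)"
      unfolding x y using BG[OF b] HG[OF h] BG[OF c] HG[OF k] by (rule mult_conj_swap)
    moreover have "b \<otimes> (h \<otimes> c \<otimes> inv h) \<in> B" using b c h norm B by (simp add: subgroup.m_closed)
    moreover have "h \<otimes> k \<in> H" using h k H by (simp add: subgroup.m_closed)
    ultimately show "\<rho> (x \<otimes>\<^bsub>G\<lparr>carrier := K\<rparr>\<^esub> y) = \<rho> x \<otimes>\<^bsub>G\<lparr>carrier := K\<rparr>\<lparr>carrier := H\<rparr>\<^esub> \<rho> y"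
      using \<rho> b c h k by (simp add: x y)
  qed
  moreover have "\<rho> h = h" if "h \<in> H" for h
    using \<rho>[OF subgroup.one_closed[OF B] that] HG[OF that] by simp
  moreover have "subgroup H (G\<lparr>carrier := K\<rparr>)" by (rule subgroup_incl[OF H K HK])
  ultimately show ?thesis
    unfolding virtual_retract_def group_retract_def using H HK fin K_def by blast
qed

text \<open>A finitely generated abelian torsion group is finite. Here generators come one at a time
  from the cyclic factors of the series, and the exponent of each matters only modulo a power lying
  in \<open>M\<close>. Keeping \<open>F\<close> inside \<open>A\<close> lets its elements commute
  with the new generator.\<close>

lemma polycyclic_torsion_cover:
  assumes poly: "polycyclic_seq G H"
    and A: "subgroup A G" and comm: "\<And>x y. \<lbrakk>x \<in> A; y \<in> A\<rbrakk> \<Longrightarrow> x \<otimes> y = y \<otimes> x"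
    and M: "subgroup M G"
    and tors: "\<And>x. x \<in> A \<Longrightarrow> \<exists>k::nat. 0 < k \<and> x [^] k \<in> M"
  shows "\<exists>F. finite F \<and> F \<subseteq> A \<and> (\<forall>x\<in>A \<inter> H. \<exists>f\<in>F. x \<otimes> inv f \<in> M)"
  using poly
proof induction
  case unity
  show ?case
    using subgroup.one_closed[OF A] subgroup.one_closed[OF M] by (intro exI[of _ "{\<one>}"]) simp
next
  case (extension K H)
  have AG: "x \<in> carrier G" if "x \<in> A" for x using subgroup.mem_carrier[OF A that] .
  obtain F where F: "finite F" "F \<subseteq> A" "\<And>x. x \<in> A \<inter> K \<Longrightarrow> \<exists>f\<in>F. x \<otimes> inv f \<in> M"
    using extension.IH by blast
  have AH: "subgroup (A \<inter> H) G" by (rule subgroups_Inter_pair[OF A extension.hyps(3)])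
  obtain g where g: "g \<in> A \<inter> H" "\<And>l. l \<in> A \<inter> H \<Longrightarrow> \<exists>k::int. l \<otimes> inv (g [^] k) \<in> K"
    using subgroup_generator_mod_cyclic_section[OF extension.hyps(2,3,4) AH Int_lower2] by metis
  obtain e :: nat where e: "0 < e" "g [^] e \<in> M" using tors g(1) by blast
  have gG: "g \<in> carrier G" using g(1) AG by blast
  have gA: "g [^] i \<in> A" for i :: int using g(1) A subgroup_int_pow_closed by blast
  \<comment> \<open>One new generator \<open>g\<close> modulo \<open>K\<close>, with exponents
    restricted to remainders modulo \<open>e\<close>.\<close>
  let ?F = "(\<lambda>(f, r). f \<otimes> g [^] r) ` (F \<times> {0..<int e})"
  have "finite ?F" using F(1) by simp
  moreover have "?F \<subseteq> A" using F(2) gA A by (auto intro!: subgroup.m_closed)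
  moreover have "\<exists>u\<in>?F. x \<otimes> inv u \<in> M" if x: "x \<in> A \<inter> H" for x
  proof -
    obtain k :: int where k: "x \<otimes> inv (g [^] k) \<in> K" using g(2)[OF x] by blast
    have "x \<otimes> inv (g [^] k) \<in> A" using x gA A by (simp add: subgroup.m_closed subgroup.m_inv_closed)
    then obtain f where f: "f \<in> F" "x \<otimes> inv (g [^] k) \<otimes> inv f \<in> M" using F(3) k by blast
    define q r where "q = k div int e" and "r = k mod int e"
    have kqr: "k = int e * q + r" by (simp add: q_def r_def)
    have fA: "f \<in> A" using f(1) F(2) by blast
    have fG: "f \<in> carrier G" and xG: "x \<in> carrier G" using fA x AG by auto
    \<comment> \<open>The part of the exponent \<open>k\<close> divisible by \<open>e\<close> gives
      an element of \<open>M\<close>; multiplying by it replaces \<open>k\<close> by its remainder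
      \<open>r\<close>.\<close>
    let ?w = "g [^] (int e * q)"
    have w: "?w = (g [^] e) [^] q" using gG by (metis int_pow_int int_pow_pow)
    have "?w \<in> M" unfolding w using e(2) M subgroup_int_pow_closed by blast
    with f(2) have "x \<otimes> inv (g [^] k) \<otimes> inv f \<otimes> ?w \<in> M" using M by (simp add: subgroup.m_closed)
    moreover have "x \<otimes> inv (g [^] k) \<otimes> inv f \<otimes> ?w = x \<otimes> inv (f \<otimes> g [^] r)"
    proof -
      have "inv f \<otimes> ?w = ?w \<otimes> inv f" using comm fA gA A by (simp add: subgroup.m_inv_closed)
      moreover have "inv (g [^] k) \<otimes> ?w = inv (g [^] r)"
      proof -
        have "inv (g [^] k) \<otimes> ?w = g [^] (- k) \<otimes> ?w" using gG by (simp add: int_pow_neg)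
        also have "\<dots> = g [^] (- k + int e * q)" using gG by (rule int_pow_mult[symmetric])
        also have "\<dots> = g [^] (- r)" by (simp add: kqr)
        finally show ?thesis using gG by (simp add: int_pow_neg)
      qed
      moreover have "x \<otimes> inv (g [^] k) \<otimes> inv f \<otimes> ?w = x \<otimes> (inv (g [^] k) \<otimes> (inv f \<otimes> ?w))"
        using fG xG gG by (simp add: m_assoc)
      moreover have "inv (g [^] k) \<otimes> (?w \<otimes> inv f) = inv (g [^] k) \<otimes> ?w \<otimes> inv f"
        using fG gG by (simp add: m_assoc)
      ultimately show ?thesis using fG gG by (simp add: inv_mult_group)
    qed
    moreover have "r \<in> {0..<int e}" using e(1) by (simp add: r_def)
    then have "f \<otimes> g [^] r \<in> ?F" using f(1) by (intro image_eqI[of _ _ "(f, r)"]) simp_all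
    ultimately show ?thesis by (intro bexI[of _ "f \<otimes> g [^] r"]) simp_all
  qed
  ultimately show ?case by (intro exI[of _ ?F] conjI ballI)
qed

text \<open>A maximal subgroup of \<open>A\<close> meeting \<open>S\<close> trivially is a complement to \<open>S\<close> up to torsion:
  adjoining any further element creates a nontrivial intersection with \<open>S\<close>.\<close>

lemma complement_up_to_torsion:
  assumes A: "subgroup A G" and comm: "\<And>x y. \<lbrakk>x \<in> A; y \<in> A\<rbrakk> \<Longrightarrow> x \<otimes> y = y \<otimes> x"
    and S: "subgroup S G"
  obtains C where "subgroup C G" "C \<subseteq> A" "C \<inter> S \<subseteq> {\<one>}"
    "\<And>x. x \<in> A \<Longrightarrow> \<exists>k::nat. 0 < k \<and> (\<exists>c\<in>C. c \<otimes> x [^] k \<in> S)"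
proof -
  have AG: "x \<in> carrier G" if "x \<in> A" for x using subgroup.mem_carrier[OF A that] .
  let ?\<A> = "{C. subgroup C G \<and> C \<subseteq> A \<and> C \<inter> S \<subseteq> {\<one>}}"
  have "\<exists>C\<in>?\<A> . \<forall>Y\<in>?\<A> . C \<subseteq> Y \<longrightarrow> Y = C"
  proof (rule subset_Zorn_nonempty)
    have "{\<one>} \<in> ?\<A>" using triv_subgroup subgroup.one_closed[OF A] by auto
    then show "?\<A> \<noteq> {}" by blast
    fix \<C> assume ne: "\<C> \<noteq> {}" and chain: "subset.chain ?\<A> \<C>"
    have sub: "subgroup C G" "C \<subseteq> A" "C \<inter> S \<subseteq> {\<one>}" if "C \<in> \<C>" for C
      using chain that by (auto simp: subset.chain_def)
    have "subgroup (\<Union>\<C>) G"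
    proof (rule subgroupI)
      show "\<Union>\<C> \<subseteq> carrier G" by (rule Union_least) (rule subgroup.subset[OF sub(1)])
      obtain C where C: "C \<in> \<C>" using ne by blast
      with subgroup.one_closed[OF sub(1)[OF C]] show "\<Union>\<C> \<noteq> {}" by blast
      show "inv a \<in> \<Union>\<C>" if a: "a \<in> \<Union>\<C>" for a
      proof -
        obtain C where C: "C \<in> \<C>" "a \<in> C" using a by blast
        with subgroup.m_inv_closed[OF sub(1)] show ?thesis by blast
      qed
      show "a \<otimes> b \<in> \<Union>\<C>" if ab: "a \<in> \<Union>\<C>" "b \<in> \<Union>\<C>" for a b
      proof -
        obtain C D where CD: "C \<in> \<C>" "a \<in> C" "D \<in> \<C>" "b \<in> D" using ab by blast
        have "C \<subseteq> D \<or> D \<subseteq> C" using subset.chain_total[OF chain CD(1,3)] by (simp add: subset_iff_psubset_eq)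
        then obtain E where "E \<in> \<C>" "a \<in> E" "b \<in> E" using CD by blast
        with subgroup.m_closed[OF sub(1)] show ?thesis by blast
      qed
    qed
    then show "\<Union>\<C> \<in> ?\<A>" using sub(2,3) by blast
  qed
  then obtain C where CA: "C \<in> ?\<A>" and maxA: "\<forall>Y\<in>?\<A>. C \<subseteq> Y \<longrightarrow> Y = C" ..
  have C: "subgroup C G" "C \<subseteq> A" "C \<inter> S \<subseteq> {\<one>}" using CA by simp_all
  have max: "Y = C" if "subgroup Y G" "Y \<subseteq> A" "Y \<inter> S \<subseteq> {\<one>}" "C \<subseteq> Y" for Y
    using bspec[OF maxA, of Y] that by simp
  have "\<exists>k::nat. 0 < k \<and> (\<exists>c\<in>C. c \<otimes> x [^] k \<in> S)" if x: "x \<in> A" for x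
  proof (cases "x \<in> C")
    case True
    \<comment> \<open>The witnesses are k = 1 and the inverse of \<open>x\<close>, whose product
      with \<open>x\<close> is trivially in \<open>S\<close>.\<close>
    have "inv x \<otimes> x [^] (1::nat) = \<one>" using AG[OF x] by simp
    then show ?thesis
      using subgroup.m_inv_closed[OF C(1) True] subgroup.one_closed[OF S] by (metis zero_less_one)
  next
    case False
    have xG: "x \<in> carrier G" using AG[OF x] .
    \<comment> \<open>The subgroup generated by \<open>C\<close> and \<open>x\<close>. It is
      strictly larger than \<open>C\<close>, so by maximality it meets \<open>S\<close>
      nontrivially.\<close>
    define D where "D = C <#> range (\<lambda>i::int. x [^] i)"
    have mem: "d \<in> D \<longleftrightarrow> (\<exists>c\<in>C. \<exists>i::int. d = c \<otimes> x [^] i)" for d by (auto simp: D_def set_mult_def)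
    have xA: "x [^] i \<in> A" for i :: int using x A subgroup_int_pow_closed by blast
    have "x [^] i \<otimes> c \<otimes> inv (x [^] i) \<in> C" if "c \<in> C" for i :: int and c
    proof -
      have "c \<in> A" using that C(2) by blast
      then have "x [^] i \<otimes> c \<otimes> inv (x [^] i) = c"
        using comm[OF xA, of c i] AG xG by (simp add: m_assoc)
      with that show ?thesis by simp
    qed
    then have D: "subgroup D G"
      unfolding D_def by (intro subgroup_set_mult_normalised C(1) cyclic_subgroup xG) auto
    have CD: "C \<subseteq> D"
    proof
      fix c assume "c \<in> C"
      then show "c \<in> D" unfolding mem using C(2) AG by (intro bexI[of _ c] exI[of _ 0]) auto
    qed
    have "x \<in> D" unfolding mem
      using xG subgroup.one_closed[OF C(1)] by (intro bexI[of _ \<one>] exI[of _ 1]) auto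
    then have "D \<noteq> C" using False by blast
    moreover have "D \<subseteq> A" using C(2) xA A by (auto simp: mem intro!: subgroup.m_closed)
    ultimately obtain d where d: "d \<in> D" "d \<in> S" "d \<noteq> \<one>" using max[OF D _ _ CD] by blast
    obtain c and i :: int where c: "c \<in> C" "d = c \<otimes> x [^] i" using d(1) unfolding mem by (elim bexE exE)
    have cA: "c \<in> A" using c(1) C(2) by blast
    have "i \<noteq> 0"
    proof
      assume "i = 0"
      then have "d = c" using c AG[OF cA] by simp
      then show False using c(1) C(3) d(2,3) by blast
    qed
    show ?thesis
    proof (cases i rule: int_cases2)
      case (nonneg n)
      then have "0 < n" "c \<otimes> x [^] n \<in> S" using \<open>i \<noteq> 0\<close> c d(2) by (simp_all add: int_pow_int)
      with c(1) show ?thesis by blast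
    next
      case (nonpos n)
      \<comment> \<open>A negative exponent is made positive by inverting \<open>d\<close>;
        commutativity restores the order of the factors.\<close>
      have "inv d = x [^] n \<otimes> inv c"
        using AG[OF cA] xG by (simp add: c(2) nonpos inv_mult_group int_pow_neg int_pow_int)
      also have "\<dots> = inv c \<otimes> x [^] n"
        using comm xA[of "int n"] cA A by (simp add: int_pow_int subgroup.m_inv_closed)
      finally have "inv c \<otimes> x [^] n \<in> S" using subgroup.m_inv_closed[OF S d(2)] by simp
      moreover have "0 < n" using nonpos \<open>i \<noteq> 0\<close> by simp
      ultimately show ?thesis using subgroup.m_inv_closed[OF C(1) c(1)] by blast
    qed
  qed
  with C that show thesis by blast
qed

section \<open>Powers and conjugation by a fixed element\<close>

lemma pow_mult_shift:
  assumes "a \<in> carrier G" "b \<in> carrier G"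
  shows "(a \<otimes> b) [^] (n::nat) \<otimes> a = a \<otimes> (b \<otimes> a) [^] n"
proof (induction n)
  case (Suc n)
  have "(a \<otimes> b) [^] Suc n \<otimes> a = ((a \<otimes> b) [^] n \<otimes> a) \<otimes> (b \<otimes> a)"
    using assms by (simp add: m_assoc)
  with Suc assms show ?case by (simp add: m_assoc)
qed (use assms in simp)

lemma conj_pow_closed:
  assumes "h \<in> carrier G" "B \<subseteq> carrier G" "\<And>b. b \<in> B \<Longrightarrow> h \<otimes> b \<otimes> inv h \<in> B" "b \<in> B"
  shows "h [^] (n::nat) \<otimes> b \<otimes> inv (h [^] n) \<in> B"
proof (induction n)
  case 0
  then show ?case using assms by auto
next
  case (Suc n)
  have "h [^] Suc n \<otimes> b \<otimes> inv (h [^] Suc n) = h \<otimes> (h [^] n \<otimes> b \<otimes> inv (h [^] n)) \<otimes> inv h"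
    unfolding nat_pow_Suc2[OF assms(1)] using assms(1,2,4) by (simp add: m_assoc inv_mult_group subsetD)
  with assms(3)[OF Suc] show ?case by simp
qed

text \<open>Conjugation by \<open>h\<close> may map an infinite \<open>B\<close> onto a proper
  subset, so stability under the inverse is a separate hypothesis.\<close>

lemma conj_int_pow_closed:
  assumes "h \<in> carrier G" "B \<subseteq> carrier G" "b \<in> B"
    and "\<And>b. b \<in> B \<Longrightarrow> h \<otimes> b \<otimes> inv h \<in> B" "\<And>b. b \<in> B \<Longrightarrow> inv h \<otimes> b \<otimes> h \<in> B"
  shows "h [^] (i::int) \<otimes> b \<otimes> inv (h [^] i) \<in> B"
proof (cases i rule: int_cases2)
  case (nonneg n)
  then show ?thesis using conj_pow_closed[of h B b n] assms by (simp add: int_pow_int)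
next
  case (nonpos n)
  then show ?thesis
    using conj_pow_closed[of "inv h" B b n] assms by (simp add: int_pow_neg int_pow_int nat_pow_inv)
qed

text \<open>Pigeonhole: two distinct exponents give the same coset of \<open>A\<close>, and their
  difference works.\<close>

lemma finite_index_pow_mem:
  assumes "finite_index A G" "h \<in> carrier G"
  obtains m :: nat where "0 < m" "h [^] m \<in> A"
proof -
  have A: "subgroup A G" "finite (rcosets A)" using assms(1) by (auto simp: finite_index_def)
  have "(\<lambda>n::nat. A #> h [^] n) ` UNIV \<subseteq> rcosets A"
    using assms(2) A(1) by (auto intro!: rcosetsI dest: subgroup.subset)
  then have "\<not> inj (\<lambda>n::nat. A #> h [^] n)"
    using A(2) by (metis finite_imageD finite_subset infinite_UNIV_nat)
  then obtain i j :: nat where "i < j" "A #> h [^] j = A #> h [^] i"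
    by (metis injI linorder_neqE_nat)
  moreover from this have "h [^] j \<otimes> inv (h [^] i) \<in> A"
    using rcos_eq_imp_mult_inv_mem[OF A(1)] assms(2) by simp
  moreover have "h [^] j \<otimes> inv (h [^] i) = h [^] (j - i)"
    using assms(2) \<open>i < j\<close> nat_pow_mult[OF assms(2), of "j - i" i]
    by (simp add: inv_solve_right')
  ultimately show thesis using that[of "j - i"] by simp
qed

end

section \<open>Invariant complements from the norm\<close>

text \<open>\<open>(xh)\<^sup>m h\<^sup>-\<^sup>m\<close> is the product of the conjugates of \<open>x\<close> by \<open>h\<^sup>0, h\<^sup>1, \<dots>\<close> (\<open>m\<close> factors),
  that is, the norm of \<open>x\<close> under conjugation by \<open>h\<close>.\<close>

definition (in group) conj_norm :: "'a \<Rightarrow> nat \<Rightarrow> 'a \<Rightarrow> 'a" where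
  "conj_norm h m x = (x \<otimes> h) [^] m \<otimes> inv (h [^] m)"

context group
begin

context
  fixes A h
  assumes A: "A \<lhd> G" and comm: "\<And>x y. \<lbrakk>x \<in> A; y \<in> A\<rbrakk> \<Longrightarrow> x \<otimes> y = y \<otimes> x"
    and h: "h \<in> carrier G"
begin

lemma A_subgroup: "subgroup A G"
  using A by (rule normal_imp_subgroup)

lemma A_carrier: "x \<in> A \<Longrightarrow> x \<in> carrier G"
  using subgroup.mem_carrier[OF A_subgroup] .

lemma conj_norm_Suc:
  assumes "x \<in> carrier G"
  shows "conj_norm h (Suc n) x = x \<otimes> (h \<otimes> conj_norm h n x \<otimes> inv h)"
  unfolding conj_norm_def nat_pow_Suc2[OF h] nat_pow_Suc2[OF m_closed[OF assms h]]
  using assms h by (simp add: m_assoc inv_mult_group)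

lemma conj_norm_mem:
  assumes "x \<in> A"
  shows "conj_norm h n x \<in> A"
proof (induction n)
  case 0
  show ?case using A_subgroup by (simp add: conj_norm_def subgroup.one_closed)
next
  case (Suc n)
  have "h \<otimes> conj_norm h n x \<otimes> inv h \<in> A" by (rule normal.inv_op_closed2[OF A h Suc])
  with assms show ?case
    by (simp add: conj_norm_Suc A_carrier subgroup.m_closed[OF A_subgroup])
qed

text \<open>By normality all conjugates of \<open>x\<close> and \<open>y\<close> lie in
  \<open>A\<close>, where factors may be rearranged.\<close>

lemma conj_norm_mult:
  assumes "x \<in> A" "y \<in> A"
  shows "conj_norm h n (x \<otimes> y) = conj_norm h n x \<otimes> conj_norm h n y"
proof (induction n)
  case 0
  show ?case by (simp add: conj_norm_def)
next
  case (Suc n)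
  define a b where "a = h \<otimes> conj_norm h n x \<otimes> inv h" and "b = h \<otimes> conj_norm h n y \<otimes> inv h"
  have ab: "a \<in> A" "b \<in> A"
    unfolding a_def b_def by (rule normal.inv_op_closed2[OF A h] conj_norm_mem assms)+
  note car = A_carrier[OF assms(1)] A_carrier[OF assms(2)] A_carrier[OF ab(1)] A_carrier[OF ab(2)]
  have "conj_norm h (Suc n) (x \<otimes> y) = x \<otimes> y \<otimes> (a \<otimes> b)"
    using car h by (simp add: conj_norm_Suc Suc a_def b_def conj_mult A_carrier conj_norm_mem assms)
  also have "\<dots> = x \<otimes> (y \<otimes> a) \<otimes> b" using car by (simp add: m_assoc)
  also have "\<dots> = (x \<otimes> a) \<otimes> (y \<otimes> b)" unfolding comm[OF assms(2) ab(1)] using car by (simp add: m_assoc)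
  finally show ?case using car by (simp add: conj_norm_Suc a_def b_def)
qed

lemma conj_norm_one: "conj_norm h n \<one> = \<one>"
  using h by (simp add: conj_norm_def)

lemma conj_norm_inv:
  assumes "x \<in> A"
  shows "conj_norm h n (inv x) = inv (conj_norm h n x)"
proof -
  have "inv x \<in> A" using assms by (rule subgroup.m_inv_closed[OF A_subgroup])
  then have "conj_norm h n (inv x) \<otimes> conj_norm h n x = \<one>"
    using conj_norm_mult[of "inv x" x n] assms A_carrier by (simp add: conj_norm_one)
  then show ?thesis
    using inv_equality A_carrier conj_norm_mem assms \<open>inv x \<in> A\<close> by metis
qed

lemma conj_norm_pow:
  assumes "x \<in> A"
  shows "conj_norm h n (x [^] (k::nat)) = conj_norm h n x [^] k"
proof (induction k)
  case (Suc k)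
  have "x [^] k \<in> A"
    using subgroup_int_pow_closed[OF A_subgroup assms, of "int k"] by (simp add: int_pow_int)
  with Suc assms show ?case by (simp add: conj_norm_mult)
qed (simp add: conj_norm_one)

text \<open>Conjugation by \<open>h\<close> fixes powers of \<open>h\<close>, so all
  \<open>n\<close> factors of the norm coincide.\<close>

lemma conj_norm_int_pow: "conj_norm h n (h [^] (l::int)) = h [^] (l * int n)"
proof -
  have "h [^] l \<otimes> h = h [^] (l + 1)" using h by (simp add: int_pow_mult)
  then have "(h [^] l \<otimes> h) [^] n = h [^] ((l + 1) * int n)"
    using h by (metis int_pow_int int_pow_pow)
  moreover have "inv (h [^] n) = h [^] (- int n)" using h by (simp add: int_pow_neg int_pow_int)
  ultimately have "conj_norm h n (h [^] l) = h [^] ((l + 1) * int n) \<otimes> h [^] (- int n)"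
    by (simp add: conj_norm_def)
  also have "\<dots> = h [^] ((l + 1) * int n + - int n)" by (rule int_pow_mult[OF h, symmetric])
  finally show ?thesis by (simp add: algebra_simps)
qed

text \<open>Conjugation by \<open>h\<close> permutes the factors of the norm cyclically, since
  \<open>h [^] m\<close> lies in the abelian \<open>A\<close> and centralises it. Instead of
  permuting factors, the proof compares (xh)^m with (hx)^m through
  \<open>pow_mult_shift\<close>.\<close>

lemma conj_norm_conj:
  assumes x: "x \<in> A" and hm: "h [^] (m::nat) \<in> A"
  shows "conj_norm h m (h \<otimes> x \<otimes> inv h) = conj_norm h m x"
proof -
  have xG: "x \<in> carrier G" using A_carrier[OF x] .
  have "x \<otimes> (h \<otimes> x) [^] m = (x \<otimes> h) [^] m \<otimes> x" using pow_mult_shift[OF xG h] by simp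
  moreover have "h \<otimes> x \<otimes> inv h \<otimes> h = h \<otimes> x" using h xG by (simp add: m_assoc)
  moreover have "x \<otimes> inv (h [^] m) = inv (h [^] m) \<otimes> x"
    using comm x subgroup.m_inv_closed[OF A_subgroup hm] by blast
  ultimately have "x \<otimes> conj_norm h m (h \<otimes> x \<otimes> inv h) = conj_norm h m x \<otimes> x"
    using h xG by (simp add: conj_norm_def m_assoc flip: m_assoc[of x])
  also have "\<dots> = x \<otimes> conj_norm h m x" using comm x conj_norm_mem by blast
  finally show ?thesis using h xG by (simp add: conj_norm_def)
qed

lemma conj_norm_conj_inv:
  assumes x: "x \<in> A" and hm: "h [^] (m::nat) \<in> A"
  shows "conj_norm h m (inv h \<otimes> x \<otimes> h) = conj_norm h m x"
proof -
  have "inv h \<otimes> x \<otimes> h \<in> A" by (rule normal.inv_op_closed1[OF A h x])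
  from conj_norm_conj[OF this hm] show ?thesis
  proof -
    have "h \<otimes> (inv h \<otimes> x \<otimes> h) \<otimes> inv h = x"
      using h A_carrier[OF x] by (simp add: m_assoc) (simp flip: m_assoc)
    with \<open>conj_norm h m (h \<otimes> (inv h \<otimes> x \<otimes> h) \<otimes> inv h) = _\<close> show ?thesis by simp
  qed
qed

section \<open>Virtual retractions onto cyclic subgroups\<close>

lemma polycyclic_finite_index_of_torsion:
  assumes fin: "finite_index A G" and poly: "polycyclic_seq G P" "A \<subseteq> P"
    and M: "subgroup M G" and tors: "\<And>x. x \<in> A \<Longrightarrow> \<exists>k::nat. 0 < k \<and> x [^] k \<in> M"
  shows "finite_index M G"
proof -
  obtain F where F: "finite F" "F \<subseteq> A" "\<forall>x\<in>A \<inter> P. \<exists>f\<in>F. x \<otimes> inv f \<in> M"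
    using polycyclic_torsion_cover[OF poly(1) A_subgroup comm M tors] by metis
  show ?thesis
  proof (rule finite_index_trans_cover[OF fin M F(1)])
    show "F \<subseteq> carrier G" using F(2) A_carrier by blast
    show "\<exists>f\<in>F. x \<otimes> inv f \<in> M" if "x \<in> A" for x using F(3) that poly(2) by blast
  qed
qed

lemma virtual_retract_cyclic:
  assumes fin: "finite_index A G" and poly: "polycyclic_seq G P" "A \<subseteq> P"
  shows "virtual_retract (range (\<lambda>i::int. h [^] i)) G"
proof -
  define S where "S = range (\<lambda>i::int. h [^] i)"
  have S: "subgroup S G" unfolding S_def by (rule cyclic_subgroup[OF h])
  have powS: "h [^] (i::int) \<in> S" for i by (simp add: S_def)
  have powA: "x [^] k \<in> A" if "x \<in> A" for x and k :: nat
    using subgroup_int_pow_closed[OF A_subgroup that, of "int k"] by (simp add: int_pow_int)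
  obtain C where C: "subgroup C G" "C \<subseteq> A" "C \<inter> S \<subseteq> {\<one>}"
    and Ctors: "\<And>x. x \<in> A \<Longrightarrow> \<exists>k::nat. 0 < k \<and> (\<exists>c\<in>C. c \<otimes> x [^] k \<in> S)"
    using complement_up_to_torsion[OF A_subgroup comm S] by metis
  have Cpow: "c [^] k \<in> C" if "c \<in> C" for c and k :: nat
    using subgroup_int_pow_closed[OF C(1) that, of "int k"] by (simp add: int_pow_int)
  have "virtual_retract S G"
  proof (cases "ord h = 0")
    \<comment> \<open>The value \<open>ord h = 0\<close> encodes infinite order, so \<open>h\<close>
      has finite order here.\<close>
    case False
    have "\<exists>k::nat. 0 < k \<and> x [^] k \<in> C" if x: "x \<in> A" for x
    proof -
      obtain k :: nat and c where k: "0 < k" and c: "c \<in> C" and S': "c \<otimes> x [^] k \<in> S"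
        using Ctors[OF x] by blast
      obtain l :: int where l: "c \<otimes> x [^] k = h [^] l" using S' unfolding S_def by (elim rangeE)
      have cA: "c \<in> A" using c C(2) by blast
      have xk: "x [^] k \<in> A" by (rule powA[OF x])
      \<comment> \<open>Raising to the power \<open>ord h\<close> kills the component in
        \<open>S\<close> and leaves a power of \<open>x\<close> in \<open>C\<close>.\<close>
      have "(c \<otimes> x [^] k) [^] ord h = h [^] (l * int (ord h))"
        unfolding l using h by (metis int_pow_int int_pow_pow)
      also have "\<dots> = \<one>" using h by (simp add: int_pow_eq_id)
      finally have "c [^] ord h \<otimes> (x [^] k) [^] ord h = \<one>"
        using pow_mult_distrib[OF comm[OF cA xk] A_carrier[OF cA] A_carrier[OF xk]] by simp
      then have "(x [^] k) [^] ord h = inv (c [^] ord h)"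
        using A_carrier[OF cA] A_carrier[OF xk] by (metis inv_equality inv_inv nat_pow_closed)
      then have "x [^] (k * ord h) \<in> C"
        using subgroup.m_inv_closed[OF C(1) Cpow[OF c]] A_carrier[OF x] by (simp add: nat_pow_pow)
      then show ?thesis using k False by (intro exI[of _ "k * ord h"]) simp
    qed
    then have "finite_index C G" by (rule polycyclic_finite_index_of_torsion[OF fin poly C(1)])
    \<comment> \<open>\<open>C\<close> need not be normalised by \<open>S\<close>; its normal core
      is, and still has finite index.\<close>
    then obtain N where N: "finite_index N G" "N \<lhd> G" "N \<subseteq> C" by (rule normal_core)
    have NG: "subgroup N G" using N(2) by (rule normal_imp_subgroup)
    have norm: "s \<otimes> b \<otimes> inv s \<in> N" if "s \<in> S" "b \<in> N" for s b
      by (rule normal.inv_op_closed2[OF N(2) subgroup.mem_carrier[OF S that(1)] that(2)])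
    have "N \<subseteq> N <#> S"
    proof
      fix x assume x: "x \<in> N"
      have "x \<otimes> \<one> \<in> N <#> S" using x subgroup.one_closed[OF S] by (auto simp: set_mult_def)
      then show "x \<in> N <#> S" using subgroup.mem_carrier[OF NG x] by simp
    qed
    then have "finite_index (N <#> S) G"
      by (rule finite_index_mono[OF N(1) _ subgroup_set_mult_normalised[OF NG S norm]])
    moreover have "N \<inter> S \<subseteq> {\<one>}" using N(3) C(3) by blast
    ultimately show ?thesis by (intro virtual_retract_of_complement[OF NG S norm])
  next
    case True
    obtain m :: nat where m: "0 < m" "h [^] m \<in> A" by (rule finite_index_pow_mem[OF fin h])
    let ?N = "conj_norm h m"
    define B where "B = {x \<in> A. ?N x \<in> C}"
    have BA: "x \<in> A" if "x \<in> B" for x using that by (simp add: B_def)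
    have B: "subgroup B G"
    proof (rule subgroupI)
      show "B \<subseteq> carrier G" using BA A_carrier by blast
      have "\<one> \<in> B"
        by (simp add: B_def conj_norm_one subgroup.one_closed[OF A_subgroup] subgroup.one_closed[OF C(1)])
      then show "B \<noteq> {}" by blast
      show "inv a \<in> B" if "a \<in> B" for a
        using that by (simp add: B_def conj_norm_inv subgroup.m_inv_closed[OF A_subgroup] subgroup.m_inv_closed[OF C(1)])
      show "a \<otimes> b \<in> B" if "a \<in> B" "b \<in> B" for a b
        using that by (simp add: B_def conj_norm_mult subgroup.m_closed[OF A_subgroup] subgroup.m_closed[OF C(1)])
    qed
    \<comment> \<open>\<open>B\<close> inherits invariance from the norm, which is constant on
      conjugates by \<open>h\<close>, whether or not \<open>C\<close> is invariant.\<close>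
    have normh: "h \<otimes> b \<otimes> inv h \<in> B" if "b \<in> B" for b
      using that m(2) normal.inv_op_closed2[OF A h] by (simp add: B_def conj_norm_conj)
    have normh': "inv h \<otimes> b \<otimes> h \<in> B" if "b \<in> B" for b
      using that m(2) normal.inv_op_closed1[OF A h] by (simp add: B_def conj_norm_conj_inv)
    have norm: "s \<otimes> b \<otimes> inv s \<in> B" if s: "s \<in> S" and b: "b \<in> B" for s b
    proof -
      obtain i :: int where "s = h [^] i" using s unfolding S_def by (elim rangeE)
      with conj_int_pow_closed[OF h subgroup.subset[OF B] b normh normh'] show ?thesis by simp
    qed
    \<comment> \<open>On powers of \<open>h\<close> the norm is the \<open>m\<close>-th power, so it
      maps \<open>B\<close> \<inter> \<open>S\<close> into \<open>C\<close> \<inter>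
      \<open>S\<close>; infinite order makes it injective there.\<close>
    have triv: "B \<inter> S \<subseteq> {\<one>}"
    proof
      fix x assume x: "x \<in> B \<inter> S"
      then obtain l :: int where l: "x = h [^] l" unfolding S_def by (elim IntE rangeE)
      have "?N x \<in> C" using x by (simp add: B_def)
      then have "h [^] (l * int m) \<in> C" by (simp add: l conj_norm_int_pow)
      then have "h [^] (l * int m) = \<one>" using C(3) powS by blast
      then have "l = 0" using True m(1) h by (simp add: int_pow_eq_id)
      then show "x \<in> {\<one>}" using l by simp
    qed
    have K: "subgroup (B <#> S) G" by (rule subgroup_set_mult_normalised[OF B S norm])
    have "\<exists>k::nat. 0 < k \<and> x [^] k \<in> B <#> S" if x: "x \<in> A" for x
    proof -
      have Nx: "?N x \<in> A" by (rule conj_norm_mem[OF x])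
      obtain k :: nat and c where k: "0 < k" and c: "c \<in> C" and S': "c \<otimes> ?N x [^] k \<in> S"
        using Ctors[OF Nx] by blast
      obtain l :: int where l: "c \<otimes> ?N x [^] k = h [^] l" using S' unfolding S_def by (elim rangeE)
      have cA: "c \<in> A" using c C(2) by blast
      have NxkA: "?N x [^] k \<in> A" by (rule powA[OF Nx])
      have hl: "h [^] l \<in> A" using l subgroup.m_closed[OF A_subgroup cA NxkA] by simp
      \<comment> \<open>The norm raises \<open>h [^] l\<close> to the power \<open>m\<close>, so
        matching it with the norm of \<open>x\<close> needs the exponent \<open>k * m\<close>. The
        powers of the norm of \<open>x\<close> then cancel and the norm of \<open>y\<close> is the
        inverse of \<open>c [^] m\<close>, an element of \<open>C\<close>.\<close>
      define y where "y = x [^] (k * m) \<otimes> inv (h [^] l)"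
      have yA: "y \<in> A"
        unfolding y_def by (intro subgroup.m_closed[OF A_subgroup] subgroup.m_inv_closed[OF A_subgroup] hl powA x)
      have "?N (h [^] l) = (h [^] l) [^] m"
        using h by (metis conj_norm_int_pow int_pow_int int_pow_pow)
      also have "\<dots> = c [^] m \<otimes> (?N x [^] k) [^] m"
        unfolding l[symmetric] by (rule pow_mult_distrib[OF comm[OF cA NxkA] A_carrier[OF cA] A_carrier[OF NxkA]])
      finally have Nhl: "?N (h [^] l) = c [^] m \<otimes> ?N x [^] (k * m)"
        using A_carrier[OF Nx] by (simp add: nat_pow_pow)
      have "?N y = ?N x [^] (k * m) \<otimes> inv (?N (h [^] l))"
        unfolding y_def
        by (simp add: conj_norm_mult conj_norm_inv conj_norm_pow powA x hl subgroup.m_inv_closed[OF A_subgroup])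
      also have "\<dots> = inv (c [^] m)"
        unfolding Nhl using A_carrier[OF Nx] A_carrier[OF cA]
        by (simp add: inv_mult_group flip: m_assoc)
      finally have "y \<in> B"
        using yA subgroup.m_inv_closed[OF C(1) Cpow[OF c]] by (simp add: B_def)
      moreover have "x [^] (k * m) = y \<otimes> h [^] l"
        using A_carrier[OF x] h by (simp add: y_def m_assoc)
      ultimately have "x [^] (k * m) \<in> B <#> S" using powS by (auto simp: set_mult_def)
      then show ?thesis using k m(1) by (intro exI[of _ "k * m"]) simp
    qed
    then have "finite_index (B <#> S) G" by (rule polycyclic_finite_index_of_torsion[OF fin poly K])
    then show ?thesis by (intro virtual_retract_of_complement[OF B S norm triv])
  qed
  then show ?thesis by (simp add: S_def)
qed

end

lemma virtually_abelian_imp_VRC: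
  assumes poly: "virtually_polycyclic G" and ab: "virtually_abelian G"
  shows "VRC G"
proof -
  obtain P where P: "finite_index P G" "polycyclic (G\<lparr>carrier := P\<rparr>)"
    using poly unfolding virtually_polycyclic_def by (elim exE conjE)
  have polyP: "polycyclic_seq G P"
    using P polycyclic_seq_subgroup[of P P] by (simp add: polycyclic_def finite_index_def)
  obtain L where L: "finite_index L G" "comm_group (G\<lparr>carrier := L\<rparr>)"
    using ab unfolding virtually_abelian_def by (elim exE conjE)
  \<comment> \<open>Taking the core of the intersection makes \<open>A\<close> normal, abelian and
    contained in the polycyclic \<open>P\<close> at once.\<close>
  obtain A where A: "finite_index A G" "A \<lhd> G" "A \<subseteq> L \<inter> P"
    by (rule normal_core[OF finite_index_Int[OF L(1) P(1)]])
  interpret L: comm_group "G\<lparr>carrier := L\<rparr>" by (rule L(2))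
  have comm: "x \<otimes> y = y \<otimes> x" if "x \<in> A" "y \<in> A" for x y
    using L.m_comm[of x y] that A(3) by auto
  have AP: "A \<subseteq> P" using A(3) by blast
  show ?thesis
    unfolding VRC_def
  proof (intro allI impI, elim conjE)
    fix H assume H: "subgroup H G" "cyclic_group (G\<lparr>carrier := H\<rparr>)"
    then obtain h where h: "h \<in> H" "H = range (\<lambda>i::int. h [^] i)" using subgroup_cyclic_iff by blast
    have "h \<in> carrier G" using subgroup.mem_carrier[OF H(1) h(1)] .
    from virtual_retract_cyclic[OF A(2) comm this A(1) polyP AP] show "virtual_retract H G"
      unfolding h(2)[symmetric] .
  qed
qed

end

section \<open>From retractions to commutators\<close>

context group
begin

text \<open>The retraction onto an abelian subgroup \<open>S\<close> kills all commutators and is the identity on \<open>S\<close>.\<close>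

lemma virtual_retract_abelian_commutators:
  assumes S: "virtual_retract S G" and comm: "\<And>x y. \<lbrakk>x \<in> S; y \<in> S\<rbrakk> \<Longrightarrow> x \<otimes> y = y \<otimes> x"
  obtains K D where "finite_index K G" "subgroup D G"
    "\<And>x y. \<lbrakk>x \<in> K; y \<in> K\<rbrakk> \<Longrightarrow> x \<otimes> y \<otimes> inv x \<otimes> inv y \<in> D" "D \<inter> S \<subseteq> {\<one>}"
proof -
  obtain K where SG: "subgroup S G" and K: "finite_index K G" and SK: "S \<subseteq> K"
    and ret: "group_retract S (G\<lparr>carrier := K\<rparr>)"
    using S unfolding virtual_retract_def by (elim exE conjE)
  have KG: "subgroup K G" using K by (rule finite_index_subgroup)
  obtain \<rho> where \<rho>: "\<rho> \<in> hom (G\<lparr>carrier := K\<rparr>) (G\<lparr>carrier := S\<rparr>)" and id: "\<forall>s\<in>S. \<rho> s = s"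
    using ret unfolding group_retract_def by auto
  interpret \<rho>: group_hom "G\<lparr>carrier := K\<rparr>" "G\<lparr>carrier := S\<rparr>" \<rho>
    using \<rho> subgroup_imp_group KG SG by (simp add: group_hom_def group_hom_axioms_def)
  have S_car: "s \<in> carrier G" if "s \<in> S" for s using subgroup.mem_carrier[OF SG that] .
  have \<rho>S: "\<rho> x \<in> S" if "x \<in> K" for x using \<rho>.hom_closed[of x] that by simp
  have \<rho>mult: "\<rho> (x \<otimes> y) = \<rho> x \<otimes> \<rho> y" if "x \<in> K" "y \<in> K" for x y
    using \<rho>.hom_mult[of x y] that by simp
  have \<rho>inv: "\<rho> (inv x) = inv (\<rho> x)" if "x \<in> K" for x
    using \<rho>.hom_inv[of x] that \<rho>S[OF that] by (simp add: KG SG)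
  have \<rho>one: "\<rho> \<one> = \<one>" using \<rho>.hom_one by simp
  \<comment> \<open>The kernel of the retraction, viewed as a subgroup of \<open>G\<close>.\<close>
  define D where "D = {x \<in> K. \<rho> x = \<one>}"
  have Kinv: "inv x \<in> K" if "x \<in> K" for x using subgroup.m_inv_closed[OF KG that] .
  have Kmult: "x \<otimes> y \<in> K" if "x \<in> K" "y \<in> K" for x y using subgroup.m_closed[OF KG that] .
  have D: "subgroup D G"
  proof (rule subgroupI)
    show "D \<subseteq> carrier G" using subgroup.subset[OF KG] by (auto simp: D_def)
    have "\<one> \<in> D" using subgroup.one_closed[OF KG] \<rho>one by (simp add: D_def)
    then show "D \<noteq> {}" by blast
    show "inv a \<in> D" if "a \<in> D" for a using that by (simp add: D_def Kinv \<rho>inv)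
    show "a \<otimes> b \<in> D" if "a \<in> D" "b \<in> D" for a b using that by (simp add: D_def Kmult \<rho>mult)
  qed
  moreover have "x \<otimes> y \<otimes> inv x \<otimes> inv y \<in> D" if x: "x \<in> K" and y: "y \<in> K" for x y
  proof -
    have "\<rho> (x \<otimes> y \<otimes> inv x \<otimes> inv y) = \<rho> x \<otimes> \<rho> y \<otimes> inv (\<rho> x) \<otimes> inv (\<rho> y)"
      using x y by (simp add: \<rho>mult \<rho>inv Kmult Kinv)
    also have "\<rho> x \<otimes> \<rho> y = \<rho> y \<otimes> \<rho> x" by (rule comm[OF \<rho>S[OF x] \<rho>S[OF y]])
    finally have "\<rho> (x \<otimes> y \<otimes> inv x \<otimes> inv y) = \<one>"
      using S_car[OF \<rho>S[OF x]] S_car[OF \<rho>S[OF y]] by (simp add: m_assoc)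
    then show ?thesis using x y by (simp add: D_def Kmult Kinv)
  qed
  moreover have "D \<inter> S \<subseteq> {\<one>}"
  proof
    fix x assume "x \<in> D \<inter> S"
    then have "\<rho> x = \<one>" "x \<in> S" by (simp_all add: D_def)
    with bspec[OF id this(2)] show "x \<in> {\<one>}" by simp
  qed
  ultimately show thesis using K that by metis
qed

text \<open>The induction climbs the series: each cyclic factor costs one application of (VRC), and
  the new pair is intersected with the old one.\<close>

lemma VRC_polycyclic_commutators:
  assumes vrc: "VRC G" and poly: "polycyclic_seq G H"
  shows "\<exists>K D. finite_index K G \<and> subgroup D G \<and>
    (\<forall>x\<in>K. \<forall>y\<in>K. x \<otimes> y \<otimes> inv x \<otimes> inv y \<in> D) \<and> D \<inter> H \<subseteq> {\<one>}"
  using poly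
proof induction
  case unity
  show ?case
    by (intro exI[of _ "carrier G"] conjI finite_index_carrier subgroup_self) auto
next
  case (extension N H)
  obtain K0 D0 where K0: "finite_index K0 G" and D0: "subgroup D0 G"
    and comm0: "\<And>x y. \<lbrakk>x \<in> K0; y \<in> K0\<rbrakk> \<Longrightarrow> x \<otimes> y \<otimes> inv x \<otimes> inv y \<in> D0"
    and triv0: "D0 \<inter> N \<subseteq> {\<one>}"
    using extension.IH by metis
  \<comment> \<open>What remains to be avoided. Since \<open>L\<close> meets \<open>N\<close>
    trivially, it embeds in the cyclic \<open>H\<close>/\<open>N\<close>, so a generator modulo
    \<open>N\<close> generates \<open>L\<close> itself.\<close>
  define L where "L = D0 \<inter> H"
  have L: "subgroup L G" unfolding L_def by (rule subgroups_Inter_pair[OF D0 extension.hyps(3)])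
  have LH: "L \<subseteq> H" and LD: "L \<subseteq> D0" by (auto simp: L_def)
  obtain g where g: "g \<in> L" "\<And>l. l \<in> L \<Longrightarrow> \<exists>k::int. l \<otimes> inv (g [^] k) \<in> N"
    using subgroup_generator_mod_cyclic_section[OF extension.hyps(2,3,4) L LH] by metis
  have gG: "g \<in> carrier G" using subgroup.mem_carrier[OF L g(1)] .
  have gL: "g [^] i \<in> L" for i :: int by (rule subgroup_int_pow_closed[OF L g(1)])
  have Lrange: "L = range (\<lambda>i::int. g [^] i)"
  proof
    show "range (\<lambda>i::int. g [^] i) \<subseteq> L" using gL by blast
    show "L \<subseteq> range (\<lambda>i::int. g [^] i)"
    proof
      fix l assume l: "l \<in> L"
      obtain k :: int where k: "l \<otimes> inv (g [^] k) \<in> N" using g(2)[OF l] by blast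
      have "l \<otimes> inv (g [^] k) \<in> L"
        by (rule subgroup.m_closed[OF L l subgroup.m_inv_closed[OF L gL]])
      then have "l \<otimes> inv (g [^] k) = \<one>" using k triv0 LD by blast
      then have "l = g [^] k"
        using subgroup.mem_carrier[OF L l] gG by (metis int_pow_closed inv_closed inv_equality inv_inv)
      then show "l \<in> range (\<lambda>i::int. g [^] i)" by blast
    qed
  qed
  have "cyclic_group (G\<lparr>carrier := L\<rparr>)" using subgroup_cyclic_iff[OF L] g(1) Lrange by blast
  then have retL: "virtual_retract L G" using vrc L unfolding VRC_def by blast
  have commL: "x \<otimes> y = y \<otimes> x" if xy: "x \<in> L" "y \<in> L" for x y
  proof -
    obtain i j :: int where "x = g [^] i" "y = g [^] j" using xy unfolding Lrange by (elim rangeE)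
    then show ?thesis using gG by (simp add: add.commute flip: int_pow_mult)
  qed
  obtain K1 D1 where K1: "finite_index K1 G" and D1: "subgroup D1 G"
    and comm1: "\<And>x y. \<lbrakk>x \<in> K1; y \<in> K1\<rbrakk> \<Longrightarrow> x \<otimes> y \<otimes> inv x \<otimes> inv y \<in> D1"
    and triv1: "D1 \<inter> L \<subseteq> {\<one>}"
    using virtual_retract_abelian_commutators[OF retL commL] by metis
  have "finite_index (K0 \<inter> K1) G" by (rule finite_index_Int[OF K0 K1])
  moreover have "subgroup (D0 \<inter> D1) G" by (rule subgroups_Inter_pair[OF D0 D1])
  moreover have "\<forall>x\<in>K0 \<inter> K1. \<forall>y\<in>K0 \<inter> K1. x \<otimes> y \<otimes> inv x \<otimes> inv y \<in> D0 \<inter> D1"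
    using comm0 comm1 by simp
  \<comment> \<open>This intersection is exactly \<open>D1\<close> \<inter>
    \<open>L\<close>.\<close>
  moreover have "D0 \<inter> D1 \<inter> H \<subseteq> {\<one>}" using triv1 by (auto simp: L_def)
  ultimately show ?case by metis
qed

lemma VRC_imp_virtually_abelian:
  assumes poly: "virtually_polycyclic G" and vrc: "VRC G"
  shows "virtually_abelian G"
proof -
  obtain P where P: "finite_index P G" "polycyclic (G\<lparr>carrier := P\<rparr>)"
    using poly unfolding virtually_polycyclic_def by (elim exE conjE)
  have PG: "subgroup P G" using P(1) by (rule finite_index_subgroup)
  have "polycyclic_seq G P"
    using P(2) polycyclic_seq_subgroup[OF _ PG, of P] by (simp add: polycyclic_def)
  from VRC_polycyclic_commutators[OF vrc this]
  obtain K D where K: "finite_index K G"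
    and comm: "\<And>x y. \<lbrakk>x \<in> K; y \<in> K\<rbrakk> \<Longrightarrow> x \<otimes> y \<otimes> inv x \<otimes> inv y \<in> D"
    and triv: "D \<inter> P \<subseteq> {\<one>}"
    by metis
  have fin: "finite_index (K \<inter> P) G" by (rule finite_index_Int[OF K P(1)])
  then have sub: "subgroup (K \<inter> P) G" by (rule finite_index_subgroup)
  have "comm_group (G\<lparr>carrier := K \<inter> P\<rparr>)"
  proof (rule group.group_comm_groupI[OF subgroup_imp_group[OF sub]])
    fix x y assume "x \<in> carrier (G\<lparr>carrier := K \<inter> P\<rparr>)" "y \<in> carrier (G\<lparr>carrier := K \<inter> P\<rparr>)"
    then have xy: "x \<in> K" "x \<in> P" "y \<in> K" "y \<in> P" by auto
    have car: "x \<in> carrier G" "y \<in> carrier G"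
      using subgroup.mem_carrier[OF PG] xy by auto
    \<comment> \<open>Intersecting \<open>K\<close> with \<open>P\<close> places the commutators in
      \<open>P\<close> as well as in \<open>D\<close>, hence in the trivial group.\<close>
    have "x \<otimes> y \<otimes> inv x \<otimes> inv y \<in> P"
      using xy by (simp add: subgroup.m_closed[OF PG] subgroup.m_inv_closed[OF PG])
    then have "x \<otimes> y \<otimes> inv x \<otimes> inv y = \<one>" using comm xy triv by blast
    then have "x \<otimes> y \<otimes> inv (y \<otimes> x) = \<one>" using car by (simp add: m_assoc inv_mult_group)
    then have "x \<otimes> y = y \<otimes> x"
      using car by (metis inv_closed inv_equality inv_inv m_closed)
    then show "x \<otimes>\<^bsub>G\<lparr>carrier := K \<inter> P\<rparr>\<^esub> y = y \<otimes>\<^bsub>G\<lparr>carrier := K \<inter> P\<rparr>\<^esub> x" by simp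
  qed
  with fin show ?thesis unfolding virtually_abelian_def by blast
qed

end

theorem proposition9p1:
  fixes G :: "('a, 'b) monoid_scheme"
  assumes "group G" and "virtually_polycyclic G"
  shows "VRC G \<longleftrightarrow> virtually_abelian G"
  using group.VRC_imp_virtually_abelian[OF assms] group.virtually_abelian_imp_VRC[OF assms] by blast

end
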